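(* If $-1<a\le0$ and $d\ge0$ are real, then for every integer $n\ge0$ and every $x\in[-1,1]$, $$\left|\mathcal B_{n,d}^{(a)}(x)\right|\le1.$$ The constant is sharp: when $d=0$, equality holds at $x=-1$.
   Context: For $a>-1$, $d\ge0$, $n\in\mathbb N_0$, $$\mathcal B_{n,d}^{(a)}(x)=\left[\frac{\Gamma(n+1)\Gamma(n+a+d+1)}{\Gamma(n+a+1)\Gamma(n+d+1)}\right]^{1/2}\left(\frac{1+x}2\right)^{d/2}P_n^{(a,d)}(x),$$ where $P_n^{(a,d)}$ is the Jacobi polynomial in the standard normalization, $P_n^{(a,d)}(1)=\frac{\Gamma(n+a+1)}{n!\,\Gamma(a+1)}$. When $d=0$ the factor $((1+x)/2)^{d/2}$ is $1$, also at $x=-1$. *)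

theory Defs
  imports "HOL-Analysis.Analysis"
begin

text \<open>The two-binomial expansion of the Jacobi polynomial obtained from Rodrigues' formula by
  Leibniz' rule (Szego, Orthogonal Polynomials, (4.3.2)). Lemma \<open>jacobi_P_at_1\<close> below confirms
  that this is the standard normalization.\<close>

definition jacobi_P :: "nat \<Rightarrow> real \<Rightarrow> real \<Rightarrow> real \<Rightarrow> real" where
  "jacobi_P n a b x =
     (\<Sum>s\<le>n. ((real n + a) gchoose (n - s)) * ((real n + b) gchoose s)
            * ((x - 1) / 2) ^ s * ((x + 1) / 2) ^ (n - s))"

lemma jacobi_P_at_1:
  assumes "a > -1"
  shows "jacobi_P n a b 1 = Gamma (real n + a + 1) / (fact n * Gamma (a + 1))"
proof -
  have "jacobi_P n a b 1 = (\<Sum>s\<le>n. if s = 0 then (real n + a) gchoose n else 0)"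
    unfolding jacobi_P_def by (rule sum.cong) auto
  also have "\<dots> = (real n + a) gchoose n"
    by simp
  also have "\<dots> = Gamma (real n + a + 1) / (fact n * Gamma (a + 1))"
    using assms by (subst gbinomial_Gamma) (auto elim!: nonpos_Ints_cases')
  finally show ?thesis .
qed

text \<open>The case distinction is needed because \<open>0 powr 0 = 0\<close>, whereas for \<open>d = 0\<close> the weight
  is to be \<open>1\<close> also at \<open>x = -1\<close>.\<close>

definition jacobi_B :: "nat \<Rightarrow> real \<Rightarrow> real \<Rightarrow> real \<Rightarrow> real" where
  "jacobi_B n d a x =
     sqrt (Gamma (real n + 1) * Gamma (real n + a + d + 1)
           / (Gamma (real n + a + 1) * Gamma (real n + d + 1)))
     * (if d = 0 then 1 else ((1 + x) / 2) powr (d / 2))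
     * jacobi_P n a d x"

end

theory Submission
  imports Defs "HOL-Complex_Analysis.Cauchy_Integral_Formula"
begin

text \<open>
  Put \<open>t = (1 + x) / 2\<close>. For \<open>a = 0\<close> and integral \<open>d\<close> the Jacobi polynomial is the coefficient of
  \<open>z ^ n\<close> in \<open>(1 - z) ^ (n + d) * (1 - t + t * z) ^ n\<close>, and Cauchy's estimate on the best circle
  around the origin gives exactly the bound one. For real \<open>d\<close> the Clebsch-Gordan decomposition
  survives in the following form: the square of \<open>t powr (d / 2)\<close> times the \<open>n\<close>-th polynomial is a
  convex combination of the corresponding functions with parameter \<open>2 d\<close> and degree at most \<open>2 n\<close>.
  Repeated squaring reduces dyadic rational \<open>d\<close> to integral \<open>d\<close>, and continuity in \<open>d\<close> gives all
  real \<open>d \<ge> 0\<close>.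

  The coefficients of the convex combination are nonnegative for the following reason. The square
  is the middle one of the products \<open>K i * K (2 n - i)\<close> of Wigner polynomials. The Jacobi
  differential operator acts on these products by a tridiagonal matrix that is self-adjoint for
  positive weights, so the coefficients of their expansions into its eigenfunctions, the Jacobi
  polynomials, are orthogonal as vectors in \<open>i\<close>. At \<open>t = 1\<close> these vectors sum to the \<open>n\<close>-th unit
  vector, hence their \<open>n\<close>-th entries are squared norms up to a positive factor.

  For \<open>-1 < a < 0\<close> the Jacobi polynomial with parameters \<open>(a, d)\<close> at \<open>t\<close> is the average of the one
  with parameters \<open>(0, d)\<close> at \<open>t s\<close>, where \<open>s\<close> has the beta distribution with parameters
  \<open>(n + a + d + 1, - a)\<close>. Inserting the bound for \<open>a = 0\<close> leaves a quotient of beta functions, which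
  is controlled by the normalising factor because \<open>Beta\<close> is log-convex in its first argument.
\<close>

subsection \<open>Polynomial bases and self-adjoint matrices\<close>

lemma smult_sum_right: "smult c (sum f A) = (\<Sum>a\<in>A. smult c (f a))"
  by (induction A rule: infinite_finite_induct) (simp_all add: smult_add_right)

lemma graded_polys_span:
  fixes W :: "nat \<Rightarrow> 'a::field poly"
  assumes degree_W: "\<And>k. degree (W k) \<le> k" and top_W: "\<And>k. coeff (W k) k \<noteq> 0"
    and "degree p \<le> L"
  shows "\<exists>C. p = (\<Sum>k\<le>L. smult (C k) (W k))"
  using \<open>degree p \<le> L\<close>
proof (induction L arbitrary: p)
  case 0
  obtain c where "p = [:c:]" using 0 by (auto elim: degree_eq_zeroE)
  moreover obtain w where "W 0 = [:w:]" using degree_W[of 0] by (auto elim: degree_eq_zeroE)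
  ultimately have "p = smult (c / w) (W 0)" using top_W[of 0] by simp
  then show ?case by auto
next
  case (Suc L)
  define c where "c = coeff p (Suc L) / coeff (W (Suc L)) (Suc L)"
  define q where "q = p - smult c (W (Suc L))"
  have "degree q \<le> L"
  proof (rule degree_le, intro allI impI)
    fix i
    assume "L < i"
    then consider "i = Suc L" | "Suc L < i" by linarith
    then show "coeff q i = 0"
      by cases (use top_W[of "Suc L"] degree_W[of "Suc L"] Suc.prems
          in \<open>simp_all add: q_def c_def coeff_eq_0\<close>)
  qed
  then obtain C where "q = (\<Sum>k\<le>L. smult (C k) (W k))" using Suc.IH by blast
  then have "p = (\<Sum>k\<le>Suc L. smult ((C(Suc L := c)) k) (W k))"
    by (simp add: q_def algebra_simps)
  then show ?case by blast
qed

lemma graded_polys_unique: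
  fixes W :: "nat \<Rightarrow> 'a::idom poly"
  assumes degree_W: "\<And>k. degree (W k) \<le> k" and top_W: "\<And>k. coeff (W k) k \<noteq> 0"
    and "(\<Sum>k\<le>L. smult (C k) (W k)) = (\<Sum>k\<le>L. smult (C' k) (W k))" and "k \<le> L"
  shows "C k = C' k"
  using assms(3,4)
proof (induction L)
  case 0
  then show ?case using top_W[of 0] by (auto dest: arg_cong[of _ _ "\<lambda>p. coeff p 0"])
next
  case (Suc L)
  have "coeff (\<Sum>j\<le>Suc L. smult (c j) (W j)) (Suc L) = c (Suc L) * coeff (W (Suc L)) (Suc L)" for c
  proof -
    have "coeff (W j) (Suc L) = 0" if "j \<le> L" for j
      using degree_W[of j] that by (simp add: coeff_eq_0)
    then show ?thesis by (simp add: coeff_sum)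
  qed
  then have "C (Suc L) = C' (Suc L)"
    using Suc.prems(1) top_W[of "Suc L"] by (metis mult_cancel_right)
  then show ?case using Suc by (cases "k = Suc L") auto
qed

definition self_adjoint_on :: "'a set \<Rightarrow> ('a \<Rightarrow> 'b::semiring_0) \<Rightarrow> (('a \<Rightarrow> 'b) \<Rightarrow> 'a \<Rightarrow> 'b) \<Rightarrow> bool" where
  "self_adjoint_on I w T \<longleftrightarrow> (\<forall>x y. (\<Sum>i\<in>I. w i * x i * T y i) = (\<Sum>i\<in>I. w i * T x i * y i))"

lemma self_adjoint_eigenvectors_orthogonal:
  fixes T :: "('a \<Rightarrow> 'b::idom) \<Rightarrow> 'a \<Rightarrow> 'b"
  assumes self_adjoint: "self_adjoint_on I w T"
    and eigen_x: "\<And>i. i \<in> I \<Longrightarrow> T x i = \<kappa> * x i"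
    and eigen_y: "\<And>i. i \<in> I \<Longrightarrow> T y i = \<mu> * y i"
    and "\<kappa> \<noteq> \<mu>"
  shows "(\<Sum>i\<in>I. w i * x i * y i) = 0"
proof -
  have "\<mu> * (\<Sum>i\<in>I. w i * x i * y i) = (\<Sum>i\<in>I. w i * x i * T y i)"
    unfolding sum_distrib_left by (rule sum.cong) (simp_all add: eigen_y)
  also have "\<dots> = (\<Sum>i\<in>I. w i * T x i * y i)"
    using self_adjoint by (simp only: self_adjoint_on_def)
  also have "\<dots> = \<kappa> * (\<Sum>i\<in>I. w i * x i * y i)"
    unfolding sum_distrib_left by (rule sum.cong) (simp_all add: eigen_x)
  finally show ?thesis using \<open>\<kappa> \<noteq> \<mu>\<close> by simp
qed

lemma eigenvector_resolution_nonneg: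
  fixes T :: "('a \<Rightarrow> 'b::linordered_idom) \<Rightarrow> 'a \<Rightarrow> 'b"
  assumes "finite I" "finite K" "n \<in> I" "k \<in> K"
    and w_pos: "\<And>i. i \<in> I \<Longrightarrow> 0 < w i" and self_adjoint: "self_adjoint_on I w T"
    and eigen: "\<And>i k. i \<in> I \<Longrightarrow> k \<in> K \<Longrightarrow> T (\<lambda>i. C i k) i = ev k * C i k"
    and "inj_on ev K"
    and sum_columns: "\<And>i. i \<in> I \<Longrightarrow> (\<Sum>k\<in>K. C i k) = (if i = n then 1 else 0)"
  shows "0 \<le> C n k"
proof -
  have orthogonal: "(\<Sum>i\<in>I. w i * C i k * C i l) = 0" if "l \<in> K" "l \<noteq> k" for l
  proof (rule self_adjoint_eigenvectors_orthogonal[OF self_adjoint])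
    show "T (\<lambda>i. C i k) i = ev k * C i k" if "i \<in> I" for i
      using that \<open>k \<in> K\<close> by (rule eigen)
    show "T (\<lambda>i. C i l) i = ev l * C i l" if "i \<in> I" for i
      using that \<open>l \<in> K\<close> by (rule eigen)
    show "ev k \<noteq> ev l"
      using that \<open>k \<in> K\<close> \<open>inj_on ev K\<close> by (auto dest: inj_onD)
  qed
  have "w n * C n k = (\<Sum>i\<in>I. if i = n then w n * C n k else 0)"
    using \<open>finite I\<close> \<open>n \<in> I\<close> by simp
  also have "\<dots> = (\<Sum>i\<in>I. w i * C i k * (\<Sum>l\<in>K. C i l))"
    by (rule sum.cong) (auto simp: sum_columns)
  also have "\<dots> = (\<Sum>l\<in>K. \<Sum>i\<in>I. w i * C i k * C i l)"
    unfolding sum_distrib_left by (rule sum.swap)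
  also have "\<dots> = (\<Sum>l\<in>K. if l = k then \<Sum>i\<in>I. w i * C i k * C i k else 0)"
    by (rule sum.cong) (auto simp: orthogonal)
  also have "\<dots> = (\<Sum>i\<in>I. w i * (C i k)\<^sup>2)"
    using \<open>finite K\<close> \<open>k \<in> K\<close> by (simp add: power2_eq_square mult.assoc)
  also have "\<dots> \<ge> 0"
    by (intro sum_nonneg mult_nonneg_nonneg) (auto simp: w_pos less_imp_le)
  finally show ?thesis using w_pos[OF \<open>n \<in> I\<close>] by (simp add: zero_le_mult_iff)
qed

definition signless_laplacian ::
    "(nat \<Rightarrow> 'a::comm_ring_1) \<Rightarrow> (nat \<Rightarrow> 'a) \<Rightarrow> (nat \<Rightarrow> 'a) \<Rightarrow> nat \<Rightarrow> 'a" where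
  "signless_laplacian a b y i = a i * (y i + y (i - 1)) + b i * (y i + y (Suc i))"

lemma signless_laplacian_form:
  assumes "a 0 = 0" "b L = 0" and balance: "\<And>i. i < L \<Longrightarrow> w (Suc i) * a (Suc i) = w i * b i"
  shows "(\<Sum>i\<le>L. w i * x i * signless_laplacian a b y i) =
    (\<Sum>i<L. w i * b i * (x i + x (Suc i)) * (y i + y (Suc i)))"
proof -
  have "(\<Sum>i\<le>L. w i * x i * signless_laplacian a b y i) =
      (\<Sum>i\<le>L. w i * a i * x i * (y i + y (i - 1))) + (\<Sum>i\<le>L. w i * b i * x i * (y i + y (Suc i)))"
    by (simp add: signless_laplacian_def algebra_simps flip: sum.distrib)
  also have "(\<Sum>i\<le>L. w i * a i * x i * (y i + y (i - 1))) =
      (\<Sum>i<L. w i * b i * x (Suc i) * (y i + y (Suc i)))"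
    by (subst sum.atMost_shift) (auto simp: \<open>a 0 = 0\<close> balance add.commute intro!: sum.cong)
  also have "(\<Sum>i\<le>L. w i * b i * x i * (y i + y (Suc i))) =
      (\<Sum>i<L. w i * b i * x i * (y i + y (Suc i)))"
    using \<open>b L = 0\<close> by (simp flip: lessThan_Suc_atMost)
  finally show ?thesis
    by (simp add: algebra_simps flip: sum.distrib)
qed

lemma signless_laplacian_self_adjoint:
  assumes "a 0 = 0" "b L = 0" and "\<And>i. i < L \<Longrightarrow> w (Suc i) * a (Suc i) = w i * b i"
  shows "self_adjoint_on {..L} w (signless_laplacian a b)"
  unfolding self_adjoint_on_def
proof (intro allI)
  fix x y
  have "(\<Sum>i\<le>L. w i * x i * signless_laplacian a b y i) =
      (\<Sum>i<L. w i * b i * (x i + x (Suc i)) * (y i + y (Suc i)))"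
    by (rule signless_laplacian_form) (use assms in auto)
  also have "\<dots> = (\<Sum>i<L. w i * b i * (y i + y (Suc i)) * (x i + x (Suc i)))"
    by (simp only: mult_ac)
  also have "\<dots> = (\<Sum>i\<le>L. w i * y i * signless_laplacian a b x i)"
    by (rule signless_laplacian_form[symmetric]) (use assms in auto)
  also have "\<dots> = (\<Sum>i\<le>L. w i * signless_laplacian a b x i * y i)"
    by (simp only: mult_ac)
  finally show "(\<Sum>i\<le>L. w i * x i * signless_laplacian a b y i) =
      (\<Sum>i\<le>L. w i * signless_laplacian a b x i * y i)" .
qed

subsection \<open>Wigner polynomials and their ladder relations\<close>

text \<open>The polynomial in \<open>t\<close> that is \<open>k!\<close> times the coefficient of \<open>z ^ k\<close> in
  \<open>(1 - z) powr (n + d) * (1 - t + t * z) ^ n\<close>, which is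
  \<open>\<Sum>j\<le>n. (n choose j) * (- t) ^ j * (1 - z) powr (n + d + j)\<close>.
  The factor \<open>k!\<close> makes the coefficient of \<open>wigner_poly n d (k - 1)\<close> in
  \<open>lower_op_wigner_poly\<close> vanish for \<open>k = 0\<close>.\<close>

definition wigner_poly :: "nat \<Rightarrow> real \<Rightarrow> nat \<Rightarrow> real poly" where
  "wigner_poly n d k =
     (\<Sum>j\<le>n. monom ((-1) ^ j * real (n choose j) * pochhammer (- (real n + d + real j)) k) j)"

lemma coeff_wigner_poly:
  "coeff (wigner_poly n d k) j =
    (-1) ^ j * real (n choose j) * pochhammer (- (real n + d + real j)) k"
  by (simp add: wigner_poly_def coeff_sum binomial_eq_0)

lemma degree_wigner_poly_le: "degree (wigner_poly n d k) \<le> n"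
  by (rule degree_le) (simp add: coeff_wigner_poly binomial_eq_0)

lemma X_mult_pderiv_wigner_poly:
  "[:0, 1:] * pderiv (wigner_poly n d k) =
    smult (real k - real n - d) (wigner_poly n d k) - wigner_poly n d (Suc k)"
proof (rule poly_eqI)
  fix j
  show "coeff ([:0, 1:] * pderiv (wigner_poly n d k)) j =
    coeff (smult (real k - real n - d) (wigner_poly n d k) - wigner_poly n d (Suc k)) j"
    by (cases j) (simp_all add: coeff_pderiv coeff_wigner_poly pochhammer_Suc algebra_simps)
qed

lemma binomial_Suc_mult:
  "real (n choose Suc j) * (real j + 1) = real (n choose j) * (real n - real j)"
  using gbinomial_absorb_comp[of "real n" j] gbinomial_absorption[of j "real n"]
  by (simp add: binomial_gbinomial algebra_simps gbinomial_mult_1)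

definition ladder_coeff :: "nat \<Rightarrow> real \<Rightarrow> nat \<Rightarrow> real" where
  "ladder_coeff n d k = real k * (2 * real n + d + 1 - real k)"

definition lower_op :: "real poly \<Rightarrow> real poly" where
  "lower_op p = [:1, -1:] * pderiv p"

lemma coeff_lower_op: "coeff (lower_op p) j = (real j + 1) * coeff p (Suc j) - real j * coeff p j"
  unfolding lower_op_def by (cases j) (simp_all add: coeff_pderiv coeff_pCons algebra_simps)

lemma lower_op_wigner_poly:
  "lower_op (wigner_poly n d k) = smult (real k - real n) (wigner_poly n d k)
     + smult (ladder_coeff n d k) (wigner_poly n d (k - 1))"
proof (rule poly_eqI)
  fix j
  define e where "e = (-1) ^ j * real (n choose j)"
  define y where "y = real n + d + real j"
  have coeff_j: "coeff (wigner_poly n d l) j = e * pochhammer (- y) l" for l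
    by (simp add: coeff_wigner_poly e_def y_def)
  have "- (real n + d + real (Suc j)) = - y - 1" by (simp add: y_def)
  then have "(real j + 1) * coeff (wigner_poly n d k) (Suc j) =
      - ((-1) ^ j * (real (n choose Suc j) * (real j + 1)) * pochhammer (- y - 1) k)"
    by (simp only: coeff_wigner_poly power_Suc mult_ac mult_1_left mult_minus_left mult_minus_right)
  then have coeff_Suc: "(real j + 1) * coeff (wigner_poly n d k) (Suc j) =
      - (e * (real n - real j) * pochhammer (- y - 1) k)"
    by (simp add: binomial_Suc_mult e_def)
  show "coeff (lower_op (wigner_poly n d k)) j =
     coeff (smult (real k - real n) (wigner_poly n d k)
       + smult (ladder_coeff n d k) (wigner_poly n d (k - 1))) j"
  proof (cases k)
    case 0
    then show ?thesis
      unfolding coeff_lower_op coeff_Suc by (simp add: coeff_j ladder_coeff_def algebra_simps)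
  next
    case (Suc m)
    define q where "q = pochhammer (- y) m"
    have pochhammer_eqs: "pochhammer (- y) k = q * (real m - y)"
        "pochhammer (- y - 1) k = (- y - 1) * q" "pochhammer (- y) (k - 1) = q"
      by (simp_all add: q_def Suc pochhammer_Suc) (simp add: pochhammer_rec flip: pochhammer_Suc)
    show ?thesis
      unfolding coeff_lower_op coeff_Suc coeff_add coeff_smult coeff_j pochhammer_eqs
      by (simp add: Suc y_def ladder_coeff_def algebra_simps)
  qed
qed

lemma wigner_poly_at_1_eq_0:
  assumes "k < n"
  shows "poly (wigner_poly n d k) 1 = 0"
  using assms
proof (induction k)
  case 0
  have "poly (lower_op (wigner_poly n d 0)) 1 = 0" by (simp add: lower_op_def)
  then show ?case using 0 by (simp add: lower_op_wigner_poly ladder_coeff_def)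
next
  case (Suc k)
  have "poly (lower_op (wigner_poly n d (Suc k))) 1 = 0" by (simp add: lower_op_def)
  then show ?case using Suc by (simp add: lower_op_wigner_poly)
qed

definition raise_op :: "real \<Rightarrow> real poly \<Rightarrow> real poly" where
  "raise_op D p = - ([:0, 1:] * pderiv p + smult (D + 1) p)"

text \<open>In unfactored form, \<open>p \<mapsto> - t (1 - t) p'' - (D + 1 - (D + 2) t) p'\<close>.\<close>

definition jacobi_op :: "real \<Rightarrow> real poly \<Rightarrow> real poly" where
  "jacobi_op D p = raise_op D (lower_op p)"

lemma lower_op_add: "lower_op (p + q) = lower_op p + lower_op q"
  by (simp add: lower_op_def pderiv_add distrib_left del: mult_pCons_left)

lemma lower_op_smult: "lower_op (smult c p) = smult c (lower_op p)"
  by (simp add: lower_op_def pderiv_smult del: mult_pCons_left)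

lemma raise_op_add: "raise_op D (p + q) = raise_op D p + raise_op D q"
  by (simp add: raise_op_def pderiv_add smult_add_right algebra_simps)

lemma raise_op_smult: "raise_op D (smult c p) = smult c (raise_op D p)"
  by (simp add: raise_op_def pderiv_smult smult_add_right smult_diff_right mult.commute)

lemma jacobi_op_smult: "jacobi_op D (smult c p) = smult c (jacobi_op D p)"
  by (simp add: jacobi_op_def lower_op_smult raise_op_smult)

lemma jacobi_op_sum: "jacobi_op D (sum f A) = (\<Sum>a\<in>A. jacobi_op D (f a))"
  by (induction A rule: infinite_finite_induct)
    (simp_all add: jacobi_op_def lower_op_add raise_op_add, simp_all add: lower_op_def raise_op_def)

lemma lower_op_wigner_poly_mult:
  fixes d :: real
  assumes "i + j = 2 * n"
  defines "K \<equiv> wigner_poly n d"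
  shows "lower_op (K i * K j) =
    smult (ladder_coeff n d i) (K (i - 1) * K j) + smult (ladder_coeff n d j) (K i * K (j - 1))"
proof -
  have ij: "2 * real n = real i + real j" using assms(1) by linarith
  have lower_K:
    "lower_op (K k) = smult (real k - real n) (K k) + smult (ladder_coeff n d k) (K (k - 1))" for k
    unfolding K_def by (rule lower_op_wigner_poly)
  have "lower_op (K i * K j) = lower_op (K i) * K j + K i * lower_op (K j)"
    by (simp add: lower_op_def pderiv_mult algebra_simps)
  also have "\<dots> = smult (real i - real n + (real j - real n)) (K i * K j)
    + (smult (ladder_coeff n d i) (K (i - 1) * K j) + smult (ladder_coeff n d j) (K i * K (j - 1)))"
    unfolding lower_K smult_add_left[of "real i - real n"]
    by (simp add: distrib_left distrib_right add_ac)
  also have "real i - real n + (real j - real n) = 0" using ij by simp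
  finally show ?thesis by simp
qed

lemma raise_op_wigner_poly_mult:
  fixes d :: real
  assumes "Suc (i + j) = 2 * n"
  defines "K \<equiv> wigner_poly n d"
  shows "raise_op (2 * d) (K i * K j) = K (Suc i) * K j + K i * K (Suc j)"
proof -
  have ij: "2 * real n = real i + real j + 1" using assms(1) by linarith
  have X_pderiv_K: "[:0, 1:] * pderiv (K k) = smult (real k - real n - d) (K k) - K (Suc k)" for k
    unfolding K_def by (rule X_mult_pderiv_wigner_poly)
  have "raise_op (2 * d) (K i * K j) =
      - (([:0, 1:] * pderiv (K i)) * K j + K i * ([:0, 1:] * pderiv (K j))
        + smult (2 * d + 1) (K i * K j))"
    by (simp add: raise_op_def pderiv_mult algebra_simps)
  also have "\<dots> = K (Suc i) * K j + K i * K (Suc j)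
      - smult (real i - real n - d + (real j - real n - d) + (2 * d + 1)) (K i * K j)"
    unfolding X_pderiv_K smult_add_left[of "real i - real n - d + (real j - real n - d)"]
      smult_add_left[of "real i - real n - d"]
    by (simp add: left_diff_distrib right_diff_distrib)
  also have "real i - real n - d + (real j - real n - d) + (2 * d + 1) = 0" using ij by simp
  finally show ?thesis by simp
qed

lemma jacobi_op_wigner_poly_mult:
  fixes d :: real
  assumes "i + j = 2 * n"
  defines "K \<equiv> wigner_poly n d"
  shows "jacobi_op (2 * d) (K i * K j) =
    smult (ladder_coeff n d i) (K i * K j + K (i - 1) * K (Suc j))
    + smult (ladder_coeff n d j) (K i * K j + K (Suc i) * K (j - 1))"
proof -
  have raise_lowered: "smult (ladder_coeff n d i) (raise_op (2 * d) (K (i - 1) * K j)) =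
      smult (ladder_coeff n d i) (K i * K j + K (i - 1) * K (Suc j))"
    if "i + j = 2 * n" for i j
  proof (cases i)
    case 0
    then show ?thesis by (simp add: ladder_coeff_def)
  next
    case (Suc m)
    then show ?thesis using raise_op_wigner_poly_mult[of m j n d] that by (simp add: K_def)
  qed
  have "jacobi_op (2 * d) (K i * K j) =
      smult (ladder_coeff n d i) (raise_op (2 * d) (K (i - 1) * K j))
      + smult (ladder_coeff n d j) (raise_op (2 * d) (K (j - 1) * K i))"
    using lower_op_wigner_poly_mult[OF assms(1), of d]
    by (simp add: jacobi_op_def raise_op_add raise_op_smult mult.commute flip: K_def)
  then show ?thesis
    using raise_lowered[of i j] raise_lowered[of j i] assms(1)
    by (simp add: mult.commute add.commute)
qed

definition jacobi_poly :: "nat \<Rightarrow> real \<Rightarrow> real poly" where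
  "jacobi_poly n d = smult (1 / fact n) (wigner_poly n d n)"

lemma coeff_jacobi_poly:
  "coeff (jacobi_poly n d) j =
    (-1) ^ (n + j) * real (n choose j) * ((real n + d + real j) gchoose n)"
proof -
  have "(-1) ^ n * ((-1) ^ n * pochhammer x n) = pochhammer x n" for x :: real
    by (simp flip: mult.assoc power_add)
  then show ?thesis
    by (simp add: jacobi_poly_def coeff_wigner_poly gbinomial_pochhammer power_add)
qed

lemma degree_jacobi_poly_le: "degree (jacobi_poly n d) \<le> n"
  using degree_smult_le degree_wigner_poly_le order_trans unfolding jacobi_poly_def by blast

lemma poly_jacobi_poly_eq_sum:
  "poly (jacobi_poly n d) t = (\<Sum>j\<le>n. coeff (jacobi_poly n d) j * t ^ j)"
  using arg_cong[OF poly_as_sum_of_monoms'[OF degree_jacobi_poly_le], of "\<lambda>p. poly p t" n d]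
  by (simp add: poly_sum poly_monom)

lemma coeff_jacobi_poly_top_nonzero:
  assumes "0 \<le> d"
  shows "coeff (jacobi_poly n d) n \<noteq> 0"
proof -
  have "pochhammer (- (real n + d + real n)) n \<noteq> 0"
    using assms by (auto simp: pochhammer_eq_0_iff)
  then show ?thesis by (simp add: jacobi_poly_def coeff_wigner_poly)
qed

lemma jacobi_op_jacobi_poly:
  "jacobi_op D (jacobi_poly k D) = smult (real k * (real k + D + 1)) (jacobi_poly k D)"
proof -
  define K where "K = wigner_poly k D"
  have raise_K: "smult (real k) (raise_op D (K (k - 1))) = smult (real k) (K k)"
  proof (cases k)
    case (Suc m)
    then show ?thesis
      unfolding raise_op_def K_def X_mult_pderiv_wigner_poly
      by (simp add: smult_add_left smult_diff_left algebra_simps)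
  qed simp
  have "lower_op (K k) = smult (real k * (real k + D + 1)) (K (k - 1))"
    by (simp add: K_def lower_op_wigner_poly ladder_coeff_def algebra_simps)
  then have "jacobi_op D (K k) = smult (real k + D + 1) (smult (real k) (raise_op D (K (k - 1))))"
    by (simp add: jacobi_op_def raise_op_smult mult.commute)
  also have "\<dots> = smult (real k * (real k + D + 1)) (K k)"
    unfolding raise_K by (simp add: mult.commute)
  finally show ?thesis
    by (simp add: jacobi_poly_def jacobi_op_smult mult.commute flip: K_def)
qed

subsection \<open>Jacobi polynomials in powers of \<open>(1 + x) / 2\<close>\<close>

lemma power_diff_one_mult_power:
  fixes t :: "'a::comm_ring_1"
  assumes "s \<le> n"
  shows "(t - 1) ^ s * t ^ (n - s) = (\<Sum>i\<le>n. (-1) ^ i * of_nat (s choose i) * t ^ (n - i))"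
proof -
  have "(t - 1) ^ s * t ^ (n - s) =
      (\<Sum>i\<le>s. of_nat (s choose i) * (-1) ^ i * t ^ (s - i) * t ^ (n - s))"
    using binomial_ring[of "-1" t s] by (simp add: sum_distrib_right)
  also have "\<dots> = (\<Sum>i\<le>s. (-1) ^ i * of_nat (s choose i) * t ^ (n - i))"
    using assms by (intro sum.cong) (auto simp: mult_ac simp flip: power_add)
  also have "\<dots> = (\<Sum>i\<le>n. (-1) ^ i * of_nat (s choose i) * t ^ (n - i))"
    using assms by (intro sum.mono_neutral_left) (auto simp: binomial_eq_0)
  finally show ?thesis .
qed

lemma gbinomial_Vandermonde_choose:
  fixes x y :: "'a::field_char_0"
  assumes "i \<le> n"
  shows "(\<Sum>s\<le>n. (x gchoose (n - s)) * (y gchoose s) * of_nat (s choose i)) =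
    (y gchoose i) * ((x + y - of_nat i) gchoose (n - i))"
proof -
  have "(\<Sum>s\<le>n. (x gchoose (n - s)) * (y gchoose s) * of_nat (s choose i)) =
      (\<Sum>s\<in>{i..n}. (x gchoose (n - s)) * (y gchoose s) * of_nat (s choose i))"
    by (rule sum.mono_neutral_right) (auto simp: binomial_eq_0)
  also have "\<dots> =
      (\<Sum>l\<in>{0..n - i}. (y gchoose i) * (((y - of_nat i) gchoose l) * (x gchoose (n - i - l))))"
  proof (rule sum.reindex_bij_witness[of _ "\<lambda>l. l + i" "\<lambda>s. s - i"])
    fix s
    assume "s \<in> {i..n}"
    then show "(y gchoose i) * (((y - of_nat i) gchoose (s - i)) * (x gchoose (n - i - (s - i)))) =
        (x gchoose (n - s)) * (y gchoose s) * of_nat (s choose i)"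
      using gbinomial_trinomial_revision[of i s y] by (simp add: binomial_gbinomial mult_ac)
  qed (use assms in auto)
  also have "\<dots> = (y gchoose i) * ((x + y - of_nat i) gchoose (n - i))"
    unfolding sum_distrib_left[symmetric] gbinomial_Vandermonde
    by (simp add: add.commute add_diff_eq)
  finally show ?thesis .
qed

lemma jacobi_P_expansion:
  "jacobi_P n a b (2 * t - 1) =
    (\<Sum>k\<le>n. (-1) ^ (n - k) * ((real n + a + b + real k) gchoose k)
      * ((real n + b) gchoose (n - k)) * t ^ k)"
proof -
  let ?x = "real n + a" and ?y = "real n + b"
  have arguments: "(2 * t - 1 - 1) / 2 = t - 1" "(2 * t - 1 + 1) / 2 = t" by auto
  have "jacobi_P n a b (2 * t - 1) =
      (\<Sum>s\<le>n. (?x gchoose (n - s)) * (?y gchoose s) * ((t - 1) ^ s * t ^ (n - s)))"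
    unfolding jacobi_P_def arguments by (simp add: mult.assoc)
  also have "\<dots> = (\<Sum>s\<le>n. (?x gchoose (n - s)) * (?y gchoose s) *
      (\<Sum>i\<le>n. (-1) ^ i * real (s choose i) * t ^ (n - i)))"
    by (rule sum.cong) (simp_all only: power_diff_one_mult_power atMost_iff)
  also have "\<dots> = (\<Sum>s\<le>n. \<Sum>i\<le>n. (-1) ^ i * t ^ (n - i) *
      ((?x gchoose (n - s)) * (?y gchoose s) * real (s choose i)))"
    by (simp only: sum_distrib_left mult_ac)
  also have "\<dots> = (\<Sum>i\<le>n. (-1) ^ i * t ^ (n - i) *
      (\<Sum>s\<le>n. (?x gchoose (n - s)) * (?y gchoose s) * real (s choose i)))"
    by (subst sum.swap) (simp add: sum_distrib_left)
  also have "\<dots> = (\<Sum>i\<le>n. (-1) ^ i * t ^ (n - i) *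
      ((?y gchoose i) * ((?x + ?y - real i) gchoose (n - i))))"
    by (rule sum.cong) (simp_all only: gbinomial_Vandermonde_choose atMost_iff)
  also have "\<dots> = (\<Sum>k\<le>n. (-1) ^ (n - k) * ((real n + a + b + real k) gchoose k)
      * (?y gchoose (n - k)) * t ^ k)"
    by (rule sum.reindex_bij_witness[of _ "\<lambda>k. n - k" "\<lambda>k. n - k"])
      (auto simp: of_nat_diff algebra_simps)
  finally show ?thesis .
qed

lemma poly_jacobi_poly: "poly (jacobi_poly n d) t = jacobi_P n 0 d (2 * t - 1)"
proof -
  have coeff_k: "coeff (jacobi_poly n d) k =
      (-1) ^ (n - k) * ((real n + 0 + d + real k) gchoose k) * ((real n + d) gchoose (n - k))"
    if "k \<le> n" for k
  proof -
    have "((real n + d + real k) gchoose n) * real (n choose k) =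
        ((real n + d + real k) gchoose k) * ((real n + d) gchoose (n - k))"
      using gbinomial_trinomial_revision[OF that, of "real n + d + real k"]
      by (simp add: binomial_gbinomial)
    moreover have "(-1 :: real) ^ (n + k) = (-1) ^ (n - k)"
      using that by (simp add: minus_one_power_iff)
    ultimately show ?thesis by (simp add: coeff_jacobi_poly mult_ac)
  qed
  show ?thesis
    unfolding jacobi_P_expansion poly_jacobi_poly_eq_sum by (simp add: coeff_k)
qed

lemma poly_jacobi_poly_at_1 [simp]: "poly (jacobi_poly n d) 1 = 1"
  using jacobi_P_at_1[of 0 n d] by (simp add: poly_jacobi_poly Gamma_fact add.commute)

subsection \<open>The Clebsch-Gordan expansion of a square\<close>

definition wigner_product :: "nat \<Rightarrow> real \<Rightarrow> nat \<Rightarrow> real poly" where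
  "wigner_product n d i = smult (1 / (fact n)\<^sup>2) (wigner_poly n d i * wigner_poly n d (2 * n - i))"

lemma wigner_product_middle: "wigner_product n d n = (jacobi_poly n d)\<^sup>2"
  by (simp add: wigner_product_def jacobi_poly_def power2_eq_square)

lemma degree_wigner_product_le: "degree (wigner_product n d i) \<le> 2 * n"
  unfolding wigner_product_def mult_2
  by (intro order_trans[OF degree_smult_le] order_trans[OF degree_mult_le] add_mono
      degree_wigner_poly_le)

lemma jacobi_op_wigner_product:
  assumes "i \<le> 2 * n"
  shows "jacobi_op (2 * d) (wigner_product n d i) =
    smult (ladder_coeff n d i) (wigner_product n d i + wigner_product n d (i - 1))
    + smult (ladder_coeff n d (2 * n - i)) (wigner_product n d i + wigner_product n d (Suc i))"
proof -
  have "ladder_coeff n d i = 0 \<or> 2 * n - (i - 1) = Suc (2 * n - i)"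
    using assms by (cases i) (auto simp: ladder_coeff_def)
  moreover have "2 * n - Suc i = 2 * n - i - 1" by simp
  ultimately show ?thesis
    using jacobi_op_wigner_poly_mult[of i "2 * n - i" n d] assms
    by (auto simp: wigner_product_def jacobi_op_smult smult_add_right mult.commute)
qed

lemma poly_wigner_product_at_1:
  assumes "i \<le> 2 * n"
  shows "poly (wigner_product n d i) 1 = (if i = n then 1 else 0)"
proof -
  consider "i < n" | "i = n" | "2 * n - i < n" using assms by linarith
  then show ?thesis
    by cases (auto simp: wigner_product_middle, auto simp: wigner_product_def wigner_poly_at_1_eq_0)
qed

definition ladder_laplacian :: "nat \<Rightarrow> real \<Rightarrow> (nat \<Rightarrow> real) \<Rightarrow> nat \<Rightarrow> real" where
  "ladder_laplacian n d = signless_laplacian (ladder_coeff n d) (\<lambda>i. ladder_coeff n d (2 * n - i))"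

lemma wigner_product_coeffs_eigen:
  assumes "0 \<le> d" "i \<le> 2 * n" "k \<le> 2 * n"
    and expansion: "\<And>i. wigner_product n d i = (\<Sum>k\<le>2 * n. smult (C i k) (jacobi_poly k (2 * d)))"
  shows "ladder_laplacian n d (\<lambda>i. C i k) i = real k * (real k + 2 * d + 1) * C i k"
proof -
  have "(\<Sum>k\<le>2 * n. smult (ladder_laplacian n d (\<lambda>i. C i k) i) (jacobi_poly k (2 * d))) =
      jacobi_op (2 * d) (wigner_product n d i)"
    unfolding jacobi_op_wigner_product[OF \<open>i \<le> 2 * n\<close>] ladder_laplacian_def signless_laplacian_def
    by (simp add: expansion smult_sum_right smult_add_left smult_add_right sum.distrib
        flip: smult_smult)
  also have "\<dots> = (\<Sum>k\<le>2 * n. smult (real k * (real k + 2 * d + 1) * C i k) (jacobi_poly k (2 * d)))"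
    unfolding expansion jacobi_op_sum jacobi_op_smult jacobi_op_jacobi_poly
    by (simp add: mult.commute)
  finally show ?thesis
    by (rule graded_polys_unique[rotated 2])
      (use assms in \<open>simp_all add: degree_jacobi_poly_le coeff_jacobi_poly_top_nonzero\<close>)
qed

lemma prod_ladder_coeff_pos:
  assumes "0 \<le> d" "m \<le> 2 * n"
  shows "0 < (\<Prod>l<m. ladder_coeff n d (Suc l))"
proof (rule prod_pos)
  fix l
  assume "l \<in> {..<m}"
  then have "real l < 2 * real n" using assms by simp
  then show "0 < ladder_coeff n d (Suc l)" using assms by (simp add: ladder_coeff_def)
qed

lemma ladder_laplacian_symmetrizable:
  assumes "0 \<le> d"
  obtains w where "\<And>i. i \<le> 2 * n \<Longrightarrow> 0 < w i"
    "self_adjoint_on {..2 * n} w (ladder_laplacian n d)"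
proof
  define M where "M m = (\<Prod>l<m. ladder_coeff n d (Suc l))" for m
  define w where "w i = 1 / (M i * M (2 * n - i))" for i
  have M_Suc: "M (Suc m) = M m * ladder_coeff n d (Suc m)" for m
    by (simp add: M_def)
  have M_pos: "0 < M m" if "m \<le> 2 * n" for m
    unfolding M_def using assms that by (rule prod_ladder_coeff_pos)
  then show "0 < w i" if "i \<le> 2 * n" for i
    using that by (simp add: w_def)
  show "self_adjoint_on {..2 * n} w (ladder_laplacian n d)"
    unfolding ladder_laplacian_def
  proof (rule signless_laplacian_self_adjoint)
    fix i
    assume i: "i < 2 * n"
    then have ratios: "M (Suc i) = M i * ladder_coeff n d (Suc i)"
        "M (2 * n - i) = M (2 * n - Suc i) * ladder_coeff n d (2 * n - i)"
      using M_Suc[of i] M_Suc[of "2 * n - Suc i"] by (simp_all add: Suc_diff_Suc)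
    have "0 < M i" "0 < M (Suc i)" "0 < M (2 * n - i)" "0 < M (2 * n - Suc i)"
      using i by (auto intro!: M_pos)
    then show "w (Suc i) * ladder_coeff n d (Suc i) = w i * ladder_coeff n d (2 * n - i)"
      by (auto simp: w_def ratios)
  qed (simp_all add: ladder_coeff_def)
qed

lemma jacobi_eigenvalue_inj:
  fixes D :: real
  assumes "0 \<le> D"
  shows "inj (\<lambda>k. real k * (real k + D + 1))"
proof (rule strict_mono_imp_inj_on, rule strict_monoI)
  fix k l :: nat
  assume "k < l"
  then show "real k * (real k + D + 1) < real l * (real l + D + 1)"
    using assms by (intro mult_strict_mono) auto
qed

lemma jacobi_poly_square_convex_combination:
  assumes "0 \<le> d"
  obtains c where "\<And>k. k \<le> 2 * n \<Longrightarrow> 0 \<le> c k" "(\<Sum>k\<le>2 * n. c k) = 1"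
    "(jacobi_poly n d)\<^sup>2 = (\<Sum>k\<le>2 * n. smult (c k) (jacobi_poly k (2 * d)))"
proof -
  have "\<exists>c. wigner_product n d i = (\<Sum>k\<le>2 * n. smult (c k) (jacobi_poly k (2 * d)))" for i
    by (rule graded_polys_span)
      (use assms in \<open>simp_all add: degree_jacobi_poly_le coeff_jacobi_poly_top_nonzero
        degree_wigner_product_le\<close>)
  then obtain C where C:
    "\<And>i. wigner_product n d i = (\<Sum>k\<le>2 * n. smult (C i k) (jacobi_poly k (2 * d)))"
    by metis
  have sum_columns: "(\<Sum>k\<le>2 * n. C i k) = (if i = n then 1 else 0)" if "i \<le> 2 * n" for i
    using poly_wigner_product_at_1[OF that, of d] by (simp add: C poly_sum)
  obtain w where w_pos: "\<And>i. i \<le> 2 * n \<Longrightarrow> 0 < w i"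
    and self_adjoint: "self_adjoint_on {..2 * n} w (ladder_laplacian n d)"
    using ladder_laplacian_symmetrizable[OF assms] by blast
  show thesis
  proof (rule that)
    fix k
    assume "k \<le> 2 * n"
    show "0 \<le> C n k"
    proof (rule eigenvector_resolution_nonneg
        [where C = C and K = "{..2 * n}", OF _ _ _ _ _ self_adjoint])
      show "ladder_laplacian n d (\<lambda>i. C i k) i = real k * (real k + 2 * d + 1) * C i k"
        if "i \<in> {..2 * n}" "k \<in> {..2 * n}" for i k
        using wigner_product_coeffs_eigen[OF assms _ _ C] that by simp
      show "inj_on (\<lambda>k. real k * (real k + 2 * d + 1)) {..2 * n}"
        using jacobi_eigenvalue_inj[of "2 * d"] assms inj_on_subset by auto
    qed (use \<open>k \<le> 2 * n\<close> w_pos sum_columns in auto)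
  next
    show "(\<Sum>k\<le>2 * n. C n k) = 1" using sum_columns[of n] by simp
    show "(jacobi_poly n d)\<^sup>2 = (\<Sum>k\<le>2 * n. smult (C n k) (jacobi_poly k (2 * d)))"
      using C[of n] by (simp add: wigner_product_middle)
  qed
qed

subsection \<open>Integral parameters\<close>

lemma Cauchy_coeff_bound:
  fixes p :: "complex poly"
  assumes "0 < r" and "\<And>z. norm z = r \<Longrightarrow> norm (poly p z) \<le> B"
  shows "norm (coeff p n) * r ^ n \<le> B"
proof -
  have "eval_fps (fps_of_poly p) = poly p" by (rule ext) simp
  then have "poly p has_fps_expansion fps_of_poly p"
    using eval_fps_has_fps_expansion[of "fps_of_poly p"] by simp
  then have deriv_0: "norm ((deriv ^^ n) (poly p) 0) = fact n * norm (coeff p n)"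
    using fps_nth_fps_expansion[of "poly p" "fps_of_poly p" n] by (simp add: norm_divide)
  have "norm ((deriv ^^ n) (poly p) 0) \<le> fact n * B / r ^ n"
    using assms by (intro Cauchy_inequality) (auto intro!: holomorphic_intros continuous_intros)
  then have "fact n * (norm (coeff p n) * r ^ n) \<le> fact n * B"
    unfolding deriv_0 using \<open>0 < r\<close> by (simp add: pos_le_divide_eq mult.assoc)
  then show ?thesis by (simp only: mult_le_cancel_left_pos fact_gt_zero)
qed

lemma jacobi_poly_generating_function:
  "complex_of_real (poly (jacobi_poly n (real D)) t) =
    coeff ([:1, -1:] ^ (n + D) * [:1 - complex_of_real t, complex_of_real t:] ^ n) n"
proof -
  let ?u = "[:1, -1 :: complex:]" and ?t = "complex_of_real t"
  have "[:1 - ?t, ?t:] ^ n = (smult (- ?t) ?u + 1) ^ n" by (simp add: one_pCons)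
  also have "\<dots> = (\<Sum>j\<le>n. smult (of_nat (n choose j) * (- ?t) ^ j) (?u ^ j))"
    by (simp only: binomial_ring smult_power power_one mult_1_right of_nat_mult_conv_smult
        smult_smult)
  finally have "?u ^ (n + D) * [:1 - ?t, ?t:] ^ n =
      (\<Sum>j\<le>n. smult (of_nat (n choose j) * (- ?t) ^ j) (?u ^ (n + D + j)))"
    by (simp add: sum_distrib_left power_add)
  then have "coeff (?u ^ (n + D) * [:1 - ?t, ?t:] ^ n) n =
      (\<Sum>j\<le>n. of_nat (n choose j) * (- ?t) ^ j * (of_nat ((n + D + j) choose n) * (-1) ^ n))"
    by (simp add: coeff_sum coeff_linear_poly_power)
  also have "\<dots> = complex_of_real
      (\<Sum>j\<le>n. (-1) ^ (n + j) * real (n choose j) * real ((n + D + j) choose n) * t ^ j)"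
    by (simp add: power_add power_minus[of ?t] mult_ac)
  also have "(\<Sum>j\<le>n. (-1) ^ (n + j) * real (n choose j) * real ((n + D + j) choose n) * t ^ j) =
      (\<Sum>j\<le>n. coeff (jacobi_poly n (real D)) j * t ^ j)"
    by (simp add: coeff_jacobi_poly binomial_gbinomial)
  also have "\<dots> = poly (jacobi_poly n (real D)) t"
    by (rule poly_jacobi_poly_eq_sum[symmetric])
  finally show ?thesis ..
qed

lemma power_mult_power_le_1_if_mean_eq_1:
  fixes x y :: real
  assumes "0 \<le> x" "0 \<le> y" and mean: "real m * x + real n * y = real m + real n"
  shows "x ^ m * y ^ n \<le> 1"
proof -
  have "x ^ m * y ^ n \<le> exp (x - 1) ^ m * exp (y - 1) ^ n"
    using assms(1,2) exp_ge_add_one_self[of "x - 1"] exp_ge_add_one_self[of "y - 1"]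
    by (intro mult_mono power_mono) auto
  also have "\<dots> = exp (real m * (x - 1) + real n * (y - 1))"
    by (simp add: exp_add exp_of_nat_mult)
  also have "real m * (x - 1) + real n * (y - 1) = 0"
    using mean by (simp add: algebra_simps)
  finally show ?thesis by simp
qed

lemma norm_convex_combination_square:
  fixes u v :: "'a::real_inner"
  shows "(norm ((1 - t) *\<^sub>R u + t *\<^sub>R v))\<^sup>2 + t * (1 - t) * (norm (u - v))\<^sup>2 =
    (1 - t) * (norm u)\<^sup>2 + t * (norm v)\<^sup>2"
  by (simp add: power2_norm_eq_inner inner_simps inner_commute algebra_simps)

text \<open>The radius is chosen so that the maximum of the left-hand side over the circle, given by the
  arithmetic-geometric mean inequality, is as small as possible.\<close>

lemma generating_function_bound_on_circle:
  fixes z :: complex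
  assumes "0 < t" "t < 1" "0 < n"
    and "(norm z)\<^sup>2 = real n * (1 - t) / ((real n + real D) * t)"
  shows "t ^ D * (norm ((1 - z) ^ (n + D) * (1 - of_real t + of_real t * z) ^ n))\<^sup>2
    \<le> (norm z ^ n)\<^sup>2"
proof -
  define X where "X = (norm (1 - z))\<^sup>2"
  define Y where "Y = (norm (1 - of_real t + of_real t * z))\<^sup>2"
  define R where "R = (norm z)\<^sup>2"
  have R: "0 < R" "(real n + real D) * (t * R) = real n * (1 - t)"
    using assms by (simp_all add: R_def)
  have "real n / (t * R) = real (n + D) / (1 - t)"
    using assms R by (simp add: field_simps)
  then have "real n * (Y / (t * R)) = real (n + D) / (1 - t) * Y"
    by (metis times_divide_eq_left times_divide_eq_right)
  then have "real (n + D) * (t * X) + real n * (Y / (t * R)) =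
      real (n + D) / (1 - t) * (t * (1 - t) * X + Y)"
    using assms by (simp add: distrib_left)
  also have "t * (1 - t) * X + Y = (1 - t) + t * R"
    using norm_convex_combination_square[of t 1 z]
    by (simp add: X_def Y_def R_def scaleR_conv_of_real add.commute)
  also have "real (n + D) / (1 - t) * ((1 - t) + t * R) = real (n + D) + real n"
    using assms R by (simp add: field_simps)
  finally have "real (n + D) * (t * X) + real n * (Y / (t * R)) = real (n + D) + real n" .
  then have "(t * X) ^ (n + D) * (Y / (t * R)) ^ n \<le> 1"
    using assms R by (intro power_mult_power_le_1_if_mean_eq_1) (simp_all add: X_def Y_def)
  then have "t ^ D * X ^ (n + D) * Y ^ n \<le> R ^ n"
    using assms R by (simp add: power_mult_distrib power_divide power_add field_simps)
  then show ?thesis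
    by (simp add: X_def Y_def R_def norm_mult norm_power power_mult_distrib mult_ac
        flip: power_mult)
qed

definition wigner_fun :: "nat \<Rightarrow> real \<Rightarrow> real \<Rightarrow> real" where
  "wigner_fun n d t = t powr (d / 2) * poly (jacobi_poly n d) t"

lemma abs_wigner_fun_nat_le_1_interior:
  assumes "0 < t" "t < 1" "0 < n"
  shows "\<bar>wigner_fun n (real D) t\<bar> \<le> 1"
proof -
  define r where "r = sqrt (real n * (1 - t) / ((real n + real D) * t))"
  have r: "0 < r" "r\<^sup>2 = real n * (1 - t) / ((real n + real D) * t)"
    using assms by (simp_all add: r_def)
  define p where "p = [:1, -1:] ^ (n + D) * [:1 - complex_of_real t, complex_of_real t:] ^ n"
  define c where "c = t powr (real D / 2)"
  have c_square: "c\<^sup>2 = t ^ D"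
    using assms by (simp add: c_def power2_eq_square powr_realpow flip: powr_add)
  have "norm (coeff (smult (of_real c) p) n) * r ^ n \<le> r ^ n"
  proof (rule Cauchy_coeff_bound[OF r(1)])
    fix z :: complex
    assume z: "norm z = r"
    have "(norm (poly (smult (of_real c) p) z))\<^sup>2 \<le> (r ^ n)\<^sup>2"
      using generating_function_bound_on_circle[of t n z D] assms r z
      by (simp add: p_def c_square norm_mult power_mult_distrib mult.commute)
    then show "norm (poly (smult (of_real c) p) z) \<le> r ^ n"
      using r(1) by (simp add: power2_le_iff_abs_le)
  qed
  then have "norm (of_real c * coeff p n) \<le> 1"
    using r(1) by simp
  moreover have "wigner_fun n (real D) t = c * poly (jacobi_poly n (real D)) t"
    by (simp add: wigner_fun_def c_def)
  ultimately show ?thesis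
    unfolding p_def jacobi_poly_generating_function[symmetric]
    by (simp only: norm_of_real flip: of_real_mult)
qed

lemma abs_wigner_fun_nat_le_1:
  assumes "0 < t" "t \<le> 1"
  shows "\<bar>wigner_fun n (real D) t\<bar> \<le> 1"
proof -
  consider "t = 1" | "n = 0" | "0 < n" "t < 1" using assms by linarith
  then show ?thesis
  proof cases
    case 1
    then show ?thesis by (simp add: wigner_fun_def)
  next
    case 2
    then show ?thesis
      using assms by (simp add: wigner_fun_def jacobi_poly_def wigner_poly_def powr_le1)
  next
    case 3
    then show ?thesis using assms abs_wigner_fun_nat_le_1_interior by blast
  qed
qed

subsection \<open>Real parameters\<close>

lemma wigner_fun_square_convex_combination:
  assumes "0 \<le> d" "0 < t"
  obtains c where "\<And>k. k \<le> 2 * n \<Longrightarrow> 0 \<le> c k" "(\<Sum>k\<le>2 * n. c k) = 1"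
    "(wigner_fun n d t)\<^sup>2 = (\<Sum>k\<le>2 * n. c k * wigner_fun k (2 * d) t)"
proof -
  obtain c where c: "\<And>k. k \<le> 2 * n \<Longrightarrow> 0 \<le> c k" "(\<Sum>k\<le>2 * n. c k) = 1"
    and square: "(jacobi_poly n d)\<^sup>2 = (\<Sum>k\<le>2 * n. smult (c k) (jacobi_poly k (2 * d)))"
    using jacobi_poly_square_convex_combination[OF assms(1), of n] by blast
  have "(wigner_fun n d t)\<^sup>2 = t powr d * poly ((jacobi_poly n d)\<^sup>2) t"
    by (simp add: wigner_fun_def power_mult_distrib power2_eq_square flip: powr_add)
  also have "\<dots> = (\<Sum>k\<le>2 * n. c k * wigner_fun k (2 * d) t)"
    unfolding square by (simp add: poly_sum wigner_fun_def sum_distrib_left mult_ac)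
  finally show thesis using that c by blast
qed

lemma abs_wigner_fun_dyadic_le_1:
  assumes "0 < t" "t \<le> 1"
  shows "\<bar>wigner_fun n (real m / 2 ^ i) t\<bar> \<le> 1"
proof (induction i arbitrary: n)
  case 0
  then show ?case using abs_wigner_fun_nat_le_1[OF assms] by simp
next
  case (Suc i)
  define d where "d = real m / 2 ^ Suc i"
  have d: "0 \<le> d" "2 * d = real m / 2 ^ i" by (auto simp: d_def)
  obtain c where c_nonneg: "\<And>k. k \<le> 2 * n \<Longrightarrow> 0 \<le> c k" and sum_c: "(\<Sum>k\<le>2 * n. c k) = 1"
    and square: "(wigner_fun n d t)\<^sup>2 = (\<Sum>k\<le>2 * n. c k * wigner_fun k (2 * d) t)"
    using wigner_fun_square_convex_combination[OF d(1) assms(1)] by blast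
  have "(wigner_fun n d t)\<^sup>2 \<le> (\<Sum>k\<le>2 * n. c k * 1)"
    unfolding square d(2) using c_nonneg Suc.IH
    by (intro sum_mono mult_left_mono) (auto simp: abs_le_iff)
  then have "(wigner_fun n d t)\<^sup>2 \<le> 1" using sum_c by simp
  then show ?case unfolding d_def by (simp only: abs_square_le_1)
qed

lemma dyadic_floor_tendsto:
  fixes x :: real
  shows "(\<lambda>i. of_int \<lfloor>x * 2 ^ i\<rfloor> / 2 ^ i) \<longlonglongrightarrow> x"
proof (rule LIM_zero_cancel, rule Lim_null_comparison)
  have "norm (of_int \<lfloor>x * 2 ^ i\<rfloor> / 2 ^ i - x) \<le> (1 / 2) ^ i" for i
  proof -
    have "of_int \<lfloor>x * 2 ^ i\<rfloor> / 2 ^ i - x = (of_int \<lfloor>x * 2 ^ i\<rfloor> - x * 2 ^ i) / 2 ^ i"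
      by (simp add: field_simps)
    moreover have "\<bar>of_int \<lfloor>x * 2 ^ i\<rfloor> - x * 2 ^ i\<bar> \<le> 1" by linarith
    ultimately show ?thesis by (simp add: power_one_over divide_right_mono)
  qed
  then show "\<forall>\<^sub>F i in sequentially. norm (of_int \<lfloor>x * 2 ^ i\<rfloor> / 2 ^ i - x) \<le> (1 / 2) ^ i" by simp
  show "(\<lambda>i. (1 / 2 :: real) ^ i) \<longlonglongrightarrow> 0" by (rule LIMSEQ_realpow_zero) auto
qed

lemma isCont_wigner_fun:
  assumes "0 < t"
  shows "isCont (\<lambda>d. wigner_fun n d t) d"
proof -
  have gbinomial_cont: "isCont (\<lambda>d. (real n + d + real j) gchoose n) d" for j
    unfolding gbinomial_prod_rev by (intro continuous_intros) auto
  show ?thesis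
    unfolding wigner_fun_def poly_jacobi_poly_eq_sum coeff_jacobi_poly
    by (intro continuous_intros gbinomial_cont) (use assms in auto)
qed

lemma abs_wigner_fun_le_1:
  assumes "0 < t" "t \<le> 1" "0 \<le> d"
  shows "\<bar>wigner_fun n d t\<bar> \<le> 1"
proof (rule LIMSEQ_le_const2)
  show "(\<lambda>i. \<bar>wigner_fun n (of_int \<lfloor>d * 2 ^ i\<rfloor> / 2 ^ i) t\<bar>) \<longlonglongrightarrow> \<bar>wigner_fun n d t\<bar>"
    by (intro tendsto_rabs isCont_tendsto_compose[OF isCont_wigner_fun[OF assms(1)]]
        dyadic_floor_tendsto)
  have "of_int \<lfloor>d * 2 ^ i\<rfloor> = real (nat \<lfloor>d * 2 ^ i\<rfloor>)" for i
    using assms(3) by simp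
  then show "\<exists>N. \<forall>i\<ge>N. \<bar>wigner_fun n (of_int \<lfloor>d * 2 ^ i\<rfloor> / 2 ^ i) t\<bar> \<le> 1"
    using abs_wigner_fun_dyadic_le_1[OF assms(1,2)] by simp
qed

subsection \<open>Negative first parameter\<close>

lemma Beta_real_pos: "0 < x \<Longrightarrow> 0 < y \<Longrightarrow> 0 < Beta x y" for x y :: real
  by (simp add: Beta_def)

lemma pochhammer_mult_Beta:
  fixes x y :: real
  assumes "0 < x" "0 < y"
  shows "pochhammer (x + y) k * Beta (x + real k) y = pochhammer x k * Beta x y"
proof -
  have "x \<notin> \<int>\<^sub>\<le>\<^sub>0" "x + y \<notin> \<int>\<^sub>\<le>\<^sub>0" using assms by (auto elim!: nonpos_Ints_cases)
  moreover have "Gamma x \<noteq> 0" "Gamma (x + y) \<noteq> 0" "Gamma (x + y + real k) \<noteq> 0"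
    using assms by (simp_all add: Gamma_real_pos less_imp_neq[symmetric])
  ultimately show ?thesis
    by (simp add: pochhammer_Gamma Beta_def add_ac)
qed

lemma log_convex_Beta_real:
  assumes "0 < z"
  shows "convex_on {0<..} (\<lambda>x :: real. ln (Beta x z))"
proof (rule f''_ge0_imp_convex)
  fix x :: real
  assume "x \<in> {0<..}"
  then have x: "0 < x" "x \<notin> \<int>\<^sub>\<le>\<^sub>0" "x + z \<notin> \<int>\<^sub>\<le>\<^sub>0" using assms by (auto elim!: nonpos_Ints_cases)
  show "((\<lambda>x. ln (Beta x z)) has_real_derivative Digamma x - Digamma (x + z)) (at x)"
    using x assms Beta_real_pos[of x z] by (auto intro!: derivative_eq_intros)
  show "((\<lambda>x. Digamma x - Digamma (x + z)) has_real_derivative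
      Polygamma 1 x - Polygamma 1 (x + z)) (at x)"
    using x by (auto intro!: derivative_eq_intros)
  show "0 \<le> Polygamma 1 x - Polygamma 1 (x + z)"
    using x assms Polygamma_real_strict_antimono[of x "x + z" 1] by simp
qed simp

lemma Beta_midpoint_log_convex:
  fixes x y z :: real
  assumes "0 < x" "0 < y" "0 < z"
  shows "(Beta ((x + y) / 2) z)\<^sup>2 \<le> Beta x z * Beta y z"
proof -
  have pos: "0 < Beta x z" "0 < Beta y z" "0 < Beta ((x + y) / 2) z"
    using assms by (auto intro!: Beta_real_pos)
  have "(x + y) / 2 = (1 - 1 / 2) *\<^sub>R x + (1 / 2) *\<^sub>R y" by simp
  then have "ln (Beta ((x + y) / 2) z) \<le> (1 - 1 / 2) * ln (Beta x z) + 1 / 2 * ln (Beta y z)"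
    using convex_onD[OF log_convex_Beta_real[OF assms(3)], of "1 / 2" x y] assms
    by (simp add: add_divide_distrib)
  then have "ln ((Beta ((x + y) / 2) z)\<^sup>2) \<le> ln (Beta x z * Beta y z)"
    using pos by (simp add: ln_mult ln_realpow)
  then show ?thesis using pos by simp
qed

lemma jacobi_P_Beta_average:
  fixes a b d t :: real and n :: nat
  defines "p \<equiv> real n + a + d + 1"
  assumes "a < b" and p_pos: "0 < p"
  shows "((\<lambda>s. s powr (p - 1) * (1 - s) powr (b - a - 1) * jacobi_P n b d (2 * (t * s) - 1))
    has_integral (Beta p (b - a) * jacobi_P n a d (2 * t - 1))) {0..1}"
proof -
  define c where "c \<alpha> k = (-1) ^ (n - k) * ((real n + \<alpha> + d + real k) gchoose k)
      * ((real n + d) gchoose (n - k)) * t ^ k" for \<alpha> k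
  have c_Beta: "c b k * Beta (p + real k) (b - a) = Beta p (b - a) * c a k" for k
  proof -
    have "(real n + b + d + real k) gchoose k = pochhammer (p + (b - a)) k / fact k"
      "(real n + a + d + real k) gchoose k = pochhammer p k / fact k"
      unfolding gbinomial_pochhammer' by (simp_all add: p_def algebra_simps)
    then have "((real n + b + d + real k) gchoose k) * Beta (p + real k) (b - a) =
        ((real n + a + d + real k) gchoose k) * Beta p (b - a)"
      using pochhammer_mult_Beta[of p "b - a" k] p_pos \<open>a < b\<close> by simp
    then show ?thesis unfolding c_def by (simp add: mult_ac)
  qed
  have sum_Beta: "(\<Sum>k\<le>n. c b k * Beta (p + real k) (b - a)) =
      Beta p (b - a) * jacobi_P n a d (2 * t - 1)"
    by (simp add: c_Beta jacobi_P_expansion sum_distrib_left flip: c_def)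
  have sum_integral: "((\<lambda>s. \<Sum>k\<le>n. c b k * (s powr (p + real k - 1) * (1 - s) powr (b - a - 1)))
      has_integral (\<Sum>k\<le>n. c b k * Beta (p + real k) (b - a))) {0..1}"
    using p_pos \<open>a < b\<close>
    by (intro has_integral_sum has_integral_mult_right has_integral_Beta_real) auto
  have integrand: "(\<Sum>k\<le>n. c b k * (s powr (p + real k - 1) * (1 - s) powr (b - a - 1))) =
      s powr (p - 1) * (1 - s) powr (b - a - 1) * jacobi_P n b d (2 * (t * s) - 1)"
    if "s \<in> {0..1}" for s
  proof -
    have "s powr (p + real k - 1) = s powr (p - 1) * s ^ k" for k
      using that by (cases "s = 0") (auto simp: powr_add powr_diff powr_realpow)
    then show ?thesis
      unfolding jacobi_P_expansion[of n b]
      by (simp add: c_def sum_distrib_left power_mult_distrib mult_ac)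
  qed
  show ?thesis
    using sum_integral unfolding sum_Beta by (rule has_integral_eq[rotated]) (rule integrand)
qed

lemma Beta_mult_weighted_jacobi_P_le:
  fixes a d t :: real and n :: nat
  assumes "-1 < a" "a < 0" "0 \<le> d" "0 < t" "t \<le> 1"
  defines "p \<equiv> real n + a + d + 1"
  shows "Beta p (- a) * (t powr (d / 2) * \<bar>jacobi_P n a d (2 * t - 1)\<bar>) \<le> Beta (p - d / 2) (- a)"
proof -
  define f where "f s = t powr (d / 2) *
      (s powr (p - 1) * (1 - s) powr (- a - 1) * jacobi_P n 0 d (2 * (t * s) - 1))" for s
  define g where "g s = s powr (p - d / 2 - 1) * (1 - s) powr (- a - 1)" for s
  have p: "0 < p" "0 < p - d / 2" using assms by (simp_all add: p_def field_simps)
  have f_integral: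
    "(f has_integral t powr (d / 2) * (Beta p (- a) * jacobi_P n a d (2 * t - 1))) {0..1}"
    unfolding f_def using jacobi_P_Beta_average[of a 0 n d t] p(1) \<open>a < 0\<close>
    by (intro has_integral_mult_right) (simp add: p_def)
  have g_integral: "(g has_integral Beta (p - d / 2) (- a)) {0..1}"
    unfolding g_def using p assms by (intro has_integral_Beta_real) auto
  have "norm (f s) \<le> g s" if "s \<in> {0..1}" for s
  proof (cases "s = 0")
    case False
    then have s: "0 < s" "s \<le> 1" using that by auto
    have "\<bar>(t * s) powr (d / 2) * jacobi_P n 0 d (2 * (t * s) - 1)\<bar> \<le> 1"
      using abs_wigner_fun_le_1[of "t * s" d n] s assms
      by (simp add: wigner_fun_def poly_jacobi_poly mult_le_one)
    then have "g s * \<bar>(t * s) powr (d / 2) * jacobi_P n 0 d (2 * (t * s) - 1)\<bar> \<le> g s"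
      by (intro mult_left_le) (auto simp: g_def)
    moreover have "s powr (p - 1) = s powr (p - d / 2 - 1) * s powr (d / 2)"
      by (simp flip: powr_add)
    ultimately show ?thesis
      using s assms by (simp add: f_def g_def abs_mult powr_mult mult_ac)
  qed (simp add: f_def g_def)
  then have "norm (integral {0..1} f) \<le> integral {0..1} g"
    using f_integral g_integral by (intro integral_norm_bound_integral) auto
  moreover have "0 < Beta p (- a)" using p assms by (intro Beta_real_pos) auto
  ultimately show ?thesis
    using f_integral g_integral by (simp add: integral_unique abs_mult mult_ac)
qed

lemma jacobi_B_eq_sqrt_Beta_quotient:
  assumes "a < 0" "0 < t"
  shows "jacobi_B n d a (2 * t - 1) =
    sqrt (Beta (real n + a + d + 1) (- a) / Beta (real n + a + 1) (- a))
    * (t powr (d / 2) * jacobi_P n a d (2 * t - 1))"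
proof -
  have "Gamma (- a) \<noteq> 0" using assms by (simp add: Gamma_real_pos less_imp_neq[symmetric])
  moreover have sums: "real n + a + 1 + - a = real n + 1" "real n + a + d + 1 + - a = real n + d + 1"
    by simp_all
  ultimately have "Beta (real n + a + d + 1) (- a) / Beta (real n + a + 1) (- a) =
      Gamma (real n + 1) * Gamma (real n + a + d + 1)
      / (Gamma (real n + a + 1) * Gamma (real n + d + 1))"
    unfolding Beta_def sums by (simp add: mult.commute)
  then show ?thesis using \<open>0 < t\<close> by (simp add: jacobi_B_def)
qed

lemma abs_jacobi_B_le_1_if_neg:
  assumes "-1 < a" "a < 0" "0 \<le> d" "0 < t" "t \<le> 1"
  shows "\<bar>jacobi_B n d a (2 * t - 1)\<bar> \<le> 1"
proof -
  define p where "p = real n + a + d + 1"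
  define q where "q = real n + a + 1"
  define P where "P = t powr (d / 2) * \<bar>jacobi_P n a d (2 * t - 1)\<bar>"
  have pq: "0 < p" "0 < q" "p - d / 2 = (q + p) / 2"
    using assms by (auto simp: p_def q_def field_simps)
  have pos: "0 < Beta p (- a)" "0 < Beta q (- a)" using pq assms by (auto intro: Beta_real_pos)
  have "(Beta p (- a) * P)\<^sup>2 \<le> (Beta ((q + p) / 2) (- a))\<^sup>2"
    using Beta_mult_weighted_jacobi_P_le[OF assms, of n] pos(1)
    by (intro power_mono) (simp_all add: P_def flip: p_def pq(3))
  also have "\<dots> \<le> Beta q (- a) * Beta p (- a)"
    using pq assms by (intro Beta_midpoint_log_convex) auto
  finally have "Beta p (- a) / Beta q (- a) * P\<^sup>2 \<le> 1"
    using pos by (simp add: power_mult_distrib power2_eq_square field_simps)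
  moreover have "\<bar>jacobi_B n d a (2 * t - 1)\<bar> = sqrt (Beta p (- a) / Beta q (- a)) * P"
    using pos jacobi_B_eq_sqrt_Beta_quotient[OF \<open>a < 0\<close> \<open>0 < t\<close>, of n d]
    by (simp add: P_def abs_mult flip: p_def q_def)
  ultimately have "\<bar>jacobi_B n d a (2 * t - 1)\<bar>\<^sup>2 \<le> 1"
    using pos by (simp add: power_mult_distrib)
  then show ?thesis by (simp only: abs_square_le_1 abs_abs)
qed

subsection \<open>The bound on the whole interval\<close>

lemma jacobi_B_0_eq_wigner_fun:
  assumes "0 < t" "0 \<le> d"
  shows "jacobi_B n d 0 (2 * t - 1) = wigner_fun n d t"
proof -
  have "Gamma (real n + 1) \<noteq> 0" "Gamma (real n + d + 1) \<noteq> 0"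
    using assms by (simp_all add: Gamma_real_pos less_imp_neq[symmetric])
  then show ?thesis
    using assms by (simp add: jacobi_B_def wigner_fun_def poly_jacobi_poly)
qed

lemma abs_jacobi_B_at_minus_1:
  assumes "-1 < a"
  shows "\<bar>jacobi_B n 0 a (-1)\<bar> = 1"
proof -
  have "jacobi_P n a 0 (-1) = (\<Sum>s\<le>n. if s = n then (-1) ^ n else 0)"
    unfolding jacobi_P_def by (rule sum.cong) (auto simp flip: binomial_gbinomial)
  then have "\<bar>jacobi_P n a 0 (-1)\<bar> = 1" by simp
  moreover have "Gamma (real n + 1) \<noteq> 0" "Gamma (real n + a + 1) \<noteq> 0"
    using assms by (simp_all add: Gamma_real_pos less_imp_neq[symmetric])
  ultimately show ?thesis by (simp add: jacobi_B_def abs_mult)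
qed

lemma abs_jacobi_B_le_1:
  assumes "-1 < a" "a \<le> 0" "0 \<le> d" "x \<in> {-1..1}"
  shows "\<bar>jacobi_B n d a x\<bar> \<le> 1"
proof -
  define t where "t = (1 + x) / 2"
  have x: "x = 2 * t - 1" by (simp add: t_def field_simps)
  have "0 \<le> t" "t \<le> 1" using assms by (simp_all add: t_def)
  then consider "x = -1" "d = 0" | "x = -1" "0 < d" | "0 < t" "a = 0" | "0 < t" "a < 0"
    using assms x by linarith
  then show ?thesis
  proof cases
    case 1
    then show ?thesis using abs_jacobi_B_at_minus_1[OF assms(1)] by simp
  next
    case 2
    then show ?thesis by (simp add: jacobi_B_def)
  next
    case 3
    then show ?thesis
      using abs_wigner_fun_le_1 \<open>t \<le> 1\<close> assms by (simp add: x jacobi_B_0_eq_wigner_fun)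
  next
    case 4
    then show ?thesis
      using abs_jacobi_B_le_1_if_neg \<open>t \<le> 1\<close> assms by (simp add: x)
  qed
qed

theorem theorem8p1:
  fixes a :: real
  assumes "-1 < a" and "a \<le> 0"
  shows "(\<forall>d\<ge>0. \<forall>n. \<forall>x\<in>{-1..1}. \<bar>jacobi_B n d a x\<bar> \<le> 1)
       \<and> (\<forall>n. \<bar>jacobi_B n 0 a (-1)\<bar> = 1)"
  using abs_jacobi_B_le_1[OF assms] abs_jacobi_B_at_minus_1[OF assms(1)] by blast

end
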